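(* Let $F \subseteq \mathbb{N}$ be large, i.e. $F = \{a_n\}_{n\in\mathbb{N}}$ for a strictly increasing sequence of positive integers $(a_n)_{n \in \mathbb{N}}$ with $\sum_{n=1}^\infty 1/a_n = \infty$. Then for all $k \in \mathbb{N}$ and $\varepsilon>0$ there exists $\delta>0$ such that one may form an arithmetic progression of length $k$ and gap length $\delta$ by moving elements in $F$ by less than $\varepsilon\delta$.
   Context: $\mathbb{N}$ denotes the positive integers. An arithmetic progression of length $k$ and gap length $\delta$ is a set of the form $\{t+\delta x : x = 0,1,\dots,k-1\}$ with $t,\delta>0$ real. The phrase "one may form an arithmetic progression of length $k$ and gap length $\delta$ by moving elements in $F$ by less than $\varepsilon\delta$" means: there exist such a progression $\{t+\delta x : x=0,\dots,k-1\}$ and elements $b_0,\dots,b_{k-1} \in F$ with $|b_x-(t+\delta x)|<\varepsilon\delta$ for every $x=0,\dots,k-1$. *)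

theory Defs
  imports "HOL-Analysis.Analysis"
begin

(* The enumeration is indexed from 0, so a n here is the (n+1)-st element of F. *)
definition large :: "nat set \<Rightarrow> bool" where
  "large F \<longleftrightarrow> (\<exists>a :: nat \<Rightarrow> nat. strict_mono a \<and> (\<forall>n. a n > 0) \<and> F = range a \<and>
     filterlim (\<lambda>N. \<Sum>n<N. 1 / real (a n)) at_top sequentially)"

(* One may form an arithmetic progression of length k and gap length \<delta> by moving elements
   in F by less than \<epsilon> * \<delta>. The chosen elements b x are not required to be distinct. *)
definition forms_AP_within :: "nat set \<Rightarrow> nat \<Rightarrow> real \<Rightarrow> real \<Rightarrow> bool" where
  "forms_AP_within F k \<delta> \<epsilon> \<longleftrightarrow> \<delta> > 0 \<and>
     (\<exists>t > 0. \<exists>b :: nat \<Rightarrow> nat. \<forall>x < k. b x \<in> F \<and>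
        \<bar>real (b x) - (t + \<delta> * real x)\<bar> < \<epsilon> * \<delta>)"

end

theory Submission
  imports Defs
begin

text \<open>
  If no approximate progression exists, then \<open>F\<close> is so thin at every scale that its reciprocals
  have a bounded sum.

  Choose \<open>M\<close> with \<open>1 / M \<le> \<epsilon>\<close> and cut an interval into \<open>q = k * M\<close> cells of equal length \<open>L\<close>.
  The left endpoints of the cells with numbers \<open>0, M, \<dots>, (k - 1) * M\<close> form a progression of gap
  \<open>M * L\<close>, and a point of such a cell is at distance less than \<open>L \<le> \<epsilon> * (M * L)\<close> from its left
  endpoint. So if \<open>F\<close> met all of these cells it would contain an approximate progression; hence
  \<open>F\<close> misses one of the \<open>q\<close> cells (\<open>cell_missed\<close>). Applying this again inside each of the other
  \<open>q - 1\<close> cells, as in the construction of a Cantor set, shows that \<open>F\<close> has at most \<open>(q - 1) ^ n\<close>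
  points in any interval of length \<open>q ^ n\<close> (\<open>card_interval_le\<close>). Therefore the reciprocals of the
  elements of \<open>F\<close> between \<open>q ^ n\<close> and \<open>q ^ (n + 1)\<close> add up to at most
  \<open>(q - 1) * ((q - 1) / q) ^ n\<close>, and summing this geometric series over \<open>n\<close> contradicts the
  divergence of the sum of reciprocals.
\<close>

lemma cell_missed:
  fixes F :: "nat set"
  assumes "\<not> forms_AP_within F k (real (M * L)) \<epsilon>"
    and "1 \<le> \<epsilon> * real M" and "M > 0" and "L > 0" and "c > 0"
  obtains x where "x < k" and "F \<inter> {c + x * M * L..<c + x * M * L + L} = {}"
proof (rule ccontr)
  assume "\<not> thesis"
  with that have "\<forall>x. \<exists>y. x < k \<longrightarrow> y \<in> F \<inter> {c + x * M * L..<c + x * M * L + L}"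
    by blast
  then obtain b where b: "\<And>x. x < k \<Longrightarrow> b x \<in> F \<inter> {c + x * M * L..<c + x * M * L + L}"
    by metis
  have close: "\<bar>real (b x) - (real c + real (M * L) * real x)\<bar> < \<epsilon> * real (M * L)"
    if "x < k" for x
  proof -
    have "real (c + x * M * L) \<le> real (b x)" "real (b x) < real (c + x * M * L + L)"
      using b[OF that] by (simp_all only: of_nat_le_iff of_nat_less_iff) auto
    then have "\<bar>real (b x) - (real c + real (M * L) * real x)\<bar> < real L"
      by (simp add: algebra_simps)
    also have "real L \<le> \<epsilon> * real M * real L"
      using mult_right_mono[OF assms(2), of "real L"] by simp
    finally show ?thesis by (simp add: mult.assoc)
  qed
  have "forms_AP_within F k (real (M * L)) \<epsilon>"
    unfolding forms_AP_within_def
    using assms b close by (intro conjI exI[of _ "real c"] exI[of _ b]) auto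
  with assms(1) show False by contradiction
qed

lemma card_interval_le:
  fixes F :: "nat set"
  assumes no_AP: "\<And>\<delta>. \<delta> > 0 \<Longrightarrow> \<not> forms_AP_within F k \<delta> \<epsilon>"
    and "1 \<le> \<epsilon> * real M" and "M > 0" and "k > 0" and "c > 0"
  shows "card (F \<inter> {c..<c + (k * M) ^ n}) \<le> (k * M - 1) ^ n"
  using \<open>c > 0\<close>
proof (induction n arbitrary: c)
  case 0
  have "card (F \<inter> {c..<c + 1}) \<le> card {c}" by (intro card_mono) auto
  then show ?case by simp
next
  case (Suc n)
  define q where "q = k * M"
  define L where "L = q ^ n"
  define cell where "cell i = F \<inter> {c + i * L..<c + i * L + L}" for i
  have "L > 0" using assms by (simp add: L_def q_def)
  then have "\<not> forms_AP_within F k (real (M * L)) \<epsilon>"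
    using assms by (intro no_AP) simp
  then obtain x where "x < k" and x: "cell (x * M) = {}"
    using cell_missed[of F k M L \<epsilon> c] assms Suc.prems \<open>L > 0\<close> unfolding cell_def by metis
  have xq: "x * M \<in> {..<q}" using \<open>x < k\<close> \<open>M > 0\<close> by (simp add: q_def)
  have "F \<inter> {c..<c + q ^ Suc n} \<subseteq> (\<Union>i\<in>{..<q} - {x * M}. cell i)"
  proof
    fix y assume y: "y \<in> F \<inter> {c..<c + q ^ Suc n}"
    define i where "i = (y - c) div L"
    have "i < q" using y by (auto simp: i_def L_def intro!: less_mult_imp_div_less)
    moreover have "y \<in> cell i"
    proof -
      have "y - c = i * L + (y - c) mod L" by (simp add: i_def)
      moreover have "(y - c) mod L < L" using \<open>L > 0\<close> by simp
      ultimately show ?thesis using y unfolding cell_def by auto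
    qed
    ultimately show "y \<in> (\<Union>i\<in>{..<q} - {x * M}. cell i)" using x by blast
  qed
  then have "card (F \<inter> {c..<c + q ^ Suc n}) \<le> card (\<Union>i\<in>{..<q} - {x * M}. cell i)"
    by (intro card_mono) (auto simp: cell_def)
  also have "\<dots> \<le> (\<Sum>i\<in>{..<q} - {x * M}. card (cell i))"
    by (intro card_UN_le) simp
  also have "\<dots> \<le> (\<Sum>i\<in>{..<q} - {x * M}. (q - 1) ^ n)"
    using Suc by (intro sum_mono) (simp add: cell_def L_def q_def)
  also have "\<dots> = (q - 1) ^ Suc n" using xq by simp
  finally show ?case by (simp only: q_def)
qed

text \<open>
  The bound is the sum of the geometric series with ratio \<open>(q - 1) / q\<close> and first term \<open>q - 1\<close>.
  Block number \<open>n\<close>, from \<open>q ^ n\<close> to \<open>q ^ Suc n\<close>, is bounded by means of the whole interval of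
  length \<open>q ^ Suc n\<close> starting at \<open>q ^ n\<close>.
\<close>
lemma sum_inverse_le_of_card_interval_le:
  fixes F :: "nat set"
  assumes card_le: "\<And>c n. c > 0 \<Longrightarrow> card (F \<inter> {c..<c + q ^ n}) \<le> (q - 1) ^ n"
    and "q > 0"
  shows "(\<Sum>m\<in>F \<inter> {1..<q ^ N}. 1 / real m) \<le> real q * real (q - 1)"
proof -
  define r where "r = real (q - 1) / real q"
  have r: "0 \<le> r" "1 - r = 1 / real q"
    using \<open>q > 0\<close> by (auto simp: r_def field_simps of_nat_diff)
  have "(\<Sum>m\<in>F \<inter> {1..<q ^ N}. 1 / real m) \<le> real (q - 1) * (\<Sum>n<N. r ^ n)"
  proof (induction N)
    case 0
    show ?case by simp
  next
    case (Suc N)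
    let ?B = "F \<inter> {q ^ N..<q ^ Suc N}"
    have "card ?B \<le> card (F \<inter> {q ^ N..<q ^ N + q ^ Suc N})"
      by (intro card_mono) auto
    also have "\<dots> \<le> (q - 1) ^ Suc N"
      using \<open>q > 0\<close> by (intro card_le) simp
    finally have B: "real (card ?B) \<le> real ((q - 1) ^ Suc N)"
      by (simp only: of_nat_le_iff)
    have "(\<Sum>m\<in>?B. 1 / real m) \<le> (\<Sum>m\<in>?B. 1 / real (q ^ N))"
    proof (intro sum_mono divide_left_mono)
      fix m assume m: "m \<in> ?B"
      then show "real (q ^ N) \<le> real m" by (simp only: of_nat_le_iff) simp
      have "0 < q ^ N" "0 < m" using m \<open>q > 0\<close> by (auto intro: less_le_trans[of 0 "q ^ N"])
      then show "0 < real m * real (q ^ N)" by (simp only: of_nat_0_less_iff mult_pos_pos)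
    qed simp
    also have "\<dots> = real (card ?B) / real (q ^ N)" by simp
    also have "\<dots> \<le> real ((q - 1) ^ Suc N) / real (q ^ N)"
      using B by (intro divide_right_mono) simp_all
    also have "\<dots> = real (q - 1) * r ^ N" by (simp add: r_def power_divide)
    finally have block: "(\<Sum>m\<in>?B. 1 / real m) \<le> real (q - 1) * r ^ N" .
    have "F \<inter> {1..<q ^ Suc N} \<subseteq> (F \<inter> {1..<q ^ N}) \<union> ?B" by auto
    then have "(\<Sum>m\<in>F \<inter> {1..<q ^ Suc N}. 1 / real m)
        \<le> (\<Sum>m\<in>(F \<inter> {1..<q ^ N}) \<union> ?B. 1 / real m)"
      by (intro sum_mono2) auto
    also have "\<dots> = (\<Sum>m\<in>F \<inter> {1..<q ^ N}. 1 / real m) + (\<Sum>m\<in>?B. 1 / real m)"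
      by (intro sum.union_disjoint) auto
    also have "\<dots> \<le> real (q - 1) * (\<Sum>n<N. r ^ n) + real (q - 1) * r ^ N"
      using Suc.IH block by (rule add_mono)
    finally show ?case by (simp add: distrib_left)
  qed
  also have "\<dots> \<le> real (q - 1) * real q"
  proof (intro mult_left_mono)
    have "(1 - r) * (\<Sum>n<N. r ^ n) = 1 - r ^ N" by (rule one_diff_power_eq[symmetric])
    then have "(\<Sum>n<N. r ^ n) = real q * (1 - r ^ N)"
      using \<open>q > 0\<close> r(2) by (simp add: field_simps)
    also have "\<dots> \<le> real q * 1" using r(1) by (intro mult_left_mono) simp_all
    finally show "(\<Sum>n<N. r ^ n) \<le> real q" by simp
  qed simp
  finally show ?thesis by (simp add: mult.commute)
qed

lemma large_sum_inverse_unbounded: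
  assumes "large F" and "q > 1"
  obtains N where "(\<Sum>m\<in>F \<inter> {1..<q ^ N}. 1 / real m) > C"
proof -
  obtain a :: "nat \<Rightarrow> nat" where a: "strict_mono a" "\<And>n. a n > 0" "F = range a"
    and div: "filterlim (\<lambda>N. \<Sum>n<N. 1 / real (a n)) at_top sequentially"
    using assms(1) unfolding large_def by blast
  obtain N where N: "C < (\<Sum>n<N. 1 / real (a n))"
    using div unfolding filterlim_at_top_dense eventually_sequentially by blast
  have "inj_on a {..<N}" using a(1) strict_mono_imp_inj_on inj_on_subset by blast
  then have "(\<Sum>n<N. 1 / real (a n)) = (\<Sum>m\<in>a ` {..<N}. 1 / real m)"
    by (simp add: sum.reindex)
  also have "\<dots> \<le> (\<Sum>m\<in>F \<inter> {1..<q ^ a N}. 1 / real m)"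
  proof (intro sum_mono2)
    have "a n < q ^ a N" if "n < N" for n
      using strict_monoD[OF a(1) that] power_gt_expt[of q "a N"] \<open>q > 1\<close> by simp
    moreover have "1 \<le> a n" for n using a(2)[of n] by simp
    ultimately show "a ` {..<N} \<subseteq> F \<inter> {1..<q ^ a N}" using a(3) by auto
  qed auto
  finally show thesis using N by (intro that[of "a N"]) simp
qed

theorem theorem2p11:
  fixes F :: "nat set"
  assumes "large F"
  shows "\<forall>k :: nat. k \<ge> 1 \<longrightarrow> (\<forall>\<epsilon> :: real. \<epsilon> > 0 \<longrightarrow>
    (\<exists>\<delta> :: real. \<delta> > 0 \<and> forms_AP_within F k \<delta> \<epsilon>))"
proof (intro allI impI, rule ccontr)
  fix k :: nat and \<epsilon> :: real
  assume k: "k \<ge> 1" and \<epsilon>: "\<epsilon> > 0"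
    and "\<not> (\<exists>\<delta>>0. forms_AP_within F k \<delta> \<epsilon>)"
  then have no_AP: "\<And>\<delta>. \<delta> > 0 \<Longrightarrow> \<not> forms_AP_within F k \<delta> \<epsilon>" by blast
  obtain m where m: "1 < real m * \<epsilon>" using reals_Archimedean3[OF \<epsilon>] by blast
  \<comment> \<open>At least two cells are needed for the powers of \<open>q\<close> to tend to infinity, even if \<open>k = 1\<close>.\<close>
  define M where "M = max 2 m"
  define q where "q = k * M"
  have "real m * \<epsilon> \<le> real M * \<epsilon>" using \<epsilon> by (intro mult_right_mono) (auto simp: M_def)
  with m have M: "1 \<le> \<epsilon> * real M" "M > 0" by (auto simp: M_def mult.commute)
  have "1 * 2 \<le> k * M" using k by (intro mult_le_mono) (auto simp: M_def)
  then have "q > 1" by (simp add: q_def)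
  obtain N where "real q * real (q - 1) < (\<Sum>m\<in>F \<inter> {1..<q ^ N}. 1 / real m)"
    using large_sum_inverse_unbounded[OF assms \<open>q > 1\<close>] .
  moreover have "(\<Sum>m\<in>F \<inter> {1..<q ^ N}. 1 / real m) \<le> real q * real (q - 1)"
    using card_interval_le[OF no_AP M] M(2) k \<open>q > 1\<close>
    by (intro sum_inverse_le_of_card_interval_le) (auto simp: q_def)
  ultimately show False by simp
qed

end
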